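(* Let $f:\mathbb{R}^n\to\mathbb{R}$ be $\nu$-smooth and $\mu$-strongly convex, let $X=[X_1,\dots,X_p]\in\mathbb{R}^{n\times p}$ have nonzero columns, and let the regularizer be $\Omega=\|\cdot\|_1$ on $\mathbb{R}^p$. Let $0<\lambda\le\lambda_{t+1}\le\lambda_t$, let $\beta_t\in\mathbb{R}^p$, and let $\theta_t$ be the associated rescaled dual feasible vector at parameter $\lambda_t$. Given the ordered sequence $d_{(1)}(\theta_t)\le\cdots\le d_{(p)}(\theta_t)$ of the values $d_1(\theta_t),\dots,d_p(\theta_t)$ and an integer $p_t$ in $[|\mathcal{A}_t(\lambda_t)|,\,p]$, it holds (a) $$\lambda_{t+1}>\frac{\lambda_t\|\theta_t\|}{\|\theta_t\|+\sqrt{\frac{\mu}{\nu}\left(d_{(p_t)}^2(\theta_t)-2\nu\,\mathcal{E}''_t\right)}}\ \Longrightarrow\ |\mathcal{A}_t(\lambda_{t+1})|<p_t,$$ and, since $\hat{\mathcal{A}}^{(\lambda_{t+1})}\subset\mathcal{A}_t(\lambda_{t+1})$, in this case also $|\hat{\mathcal{A}}^{(\lambda_{t+1})}|<p_t$; (b) $$\lambda_{t+1}\le\frac{\lambda_t\|\theta_t\|}{\|\theta_t\|+\sqrt{d_{(p_t)}^2(\theta_t)-2\nu\,\mathcal{E}'_t}}\ \Longrightarrow\ |\mathcal{A}_t(\lambda_{t+1})|\ge p_t.$$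
   Context: Norms on $\mathbb{R}^n$ are Euclidean. A differentiable function $f$ is $\nu$-smooth and $\mu$-strongly convex ($0<\mu\le\nu$) if for all $z,z_0$: $\frac{\mu}{2}\|z-z_0\|^2\le f(z)-f(z_0)-\langle\nabla f(z_0),z-z_0\rangle\le\frac{\nu}{2}\|z-z_0\|^2$. The Fenchel conjugate is $f^*(u)=\sup_{x}\langle u,x\rangle-f(x)$. For $\gamma>0$: $P_\gamma(\beta)=f(X\beta)+\gamma\|\beta\|_1$; a vector $\theta\in\mathbb{R}^n$ is dual feasible if $|X_j^\top\theta|\le1$ for all $j$; for feasible $\theta$ the dual objective is $D_\gamma(\theta)=-f^*(-\gamma\theta)$, and $\hat\theta^{(\gamma)}$ denotes the maximizer of $D_\gamma$ over dual feasible vectors; the duality gap is $\mathrm{Gap}_\gamma(\beta,\theta)=P_\gamma(\beta)-D_\gamma(\theta)$. The rescaled dual vector is $\theta_t=-\nabla f(X\beta_t)/\alpha_t$ with $\alpha_t=\max(\lambda_t,\|X^\top\nabla f(X\beta_t)\|_\infty)$. Further notation: $\zeta_t=-\lambda_t\theta_t$; $\mathrm{Gap}_t=\mathrm{Gap}_{\lambda_t}(\beta_t,\theta_t)$; $\Delta_t=f(X\beta_t)-f(\nabla f^*(\zeta_t))$; $$\mathcal{E}'_t=\frac{1}{\lambda_t^2}\mathrm{Gap}_t+\left(\frac1{\lambda^2}-\frac1{\lambda_t^2}\right)\min(0,\Delta_t),\qquad \mathcal{E}''_t=\frac{1}{\lambda\lambda_t}\mathrm{Gap}_t+\left(\frac1{\lambda^2}-\frac1{\lambda_t^2}\right)\max(0,\Delta_t).$$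 $d_j(\theta)=\dfrac{1-|X_j^\top\theta|}{\|X_j\|}$; for $\gamma>0$, the safe radius is $r_t(\gamma)=\sqrt{\frac{2\nu}{\gamma^2}\mathrm{Gap}_\gamma(\beta_t,\theta_t)}$, the sequential safe active set is $\mathcal{A}_t(\gamma)=\{j\in\{1,\dots,p\}: d_j(\theta_t)\le r_t(\gamma)\}$, and the optimal active set is $\hat{\mathcal{A}}^{(\gamma)}=\{j\in\{1,\dots,p\}: d_j(\hat\theta^{(\gamma)})=0\}$. *)

theory Defs
  imports "HOL-Analysis.Analysis"
begin

definition gradient :: "('a::real_inner \<Rightarrow> real) \<Rightarrow> 'a \<Rightarrow> 'a" where
  "gradient f x = (THE D. GDERIV f x :> D)"

definition smooth_strongly_convex :: "real \<Rightarrow> real \<Rightarrow> ('a::euclidean_space \<Rightarrow> real) \<Rightarrow> bool" where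
  "smooth_strongly_convex \<mu> \<nu> f \<longleftrightarrow>
     0 < \<mu> \<and> \<mu> \<le> \<nu> \<and> (\<forall>z. f differentiable (at z)) \<and>
     (\<forall>z z0. \<mu> / 2 * (norm (z - z0))\<^sup>2 \<le> f z - f z0 - gradient f z0 \<bullet> (z - z0) \<and>
             f z - f z0 - gradient f z0 \<bullet> (z - z0) \<le> \<nu> / 2 * (norm (z - z0))\<^sup>2)"

(* The supremum is taken in the reals. It is the usual one whenever x \<mapsto> u \<bullet> x - f x is bounded
   above for every u, which is the case for strongly convex f. *)
definition fenchel_conj :: "('a::euclidean_space \<Rightarrow> real) \<Rightarrow> 'a \<Rightarrow> real" where
  "fenchel_conj f u = (SUP x. u \<bullet> x - f x)"

definition l1_norm :: "real^'p \<Rightarrow> real" where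
  "l1_norm \<beta> = (\<Sum>j\<in>UNIV. \<bar>\<beta> $ j\<bar>)"

definition primal_obj :: "(real^'n \<Rightarrow> real) \<Rightarrow> real^'p^'n \<Rightarrow> real \<Rightarrow> real^'p \<Rightarrow> real" where
  "primal_obj f X \<gamma> \<beta> = f (X *v \<beta>) + \<gamma> * l1_norm \<beta>"

definition dual_feasible :: "real^'p^'n \<Rightarrow> (real^'n) set" where
  "dual_feasible X = {\<theta>. \<forall>j. \<bar>column j X \<bullet> \<theta>\<bar> \<le> 1}"

definition dual_obj :: "(real^'n \<Rightarrow> real) \<Rightarrow> real \<Rightarrow> real^'n \<Rightarrow> real" where
  "dual_obj f \<gamma> \<theta> = - fenchel_conj f (- (\<gamma> *\<^sub>R \<theta>))"

(* For f smooth and strongly convex and \<gamma> > 0 the dual objective is strongly concave and the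
   feasible set is closed and contains 0, so the maximizer exists and is unique. *)
definition dual_opt :: "(real^'n \<Rightarrow> real) \<Rightarrow> real^'p^'n \<Rightarrow> real \<Rightarrow> real^'n" where
  "dual_opt f X \<gamma> = arg_max_on (dual_obj f \<gamma>) (dual_feasible X)"

definition duality_gap ::
  "(real^'n \<Rightarrow> real) \<Rightarrow> real^'p^'n \<Rightarrow> real \<Rightarrow> real^'p \<Rightarrow> real^'n \<Rightarrow> real" where
  "duality_gap f X \<gamma> \<beta> \<theta> = primal_obj f X \<gamma> \<beta> - dual_obj f \<gamma> \<theta>"

definition rescaled_dual ::
  "(real^'n \<Rightarrow> real) \<Rightarrow> real^'p^'n \<Rightarrow> real \<Rightarrow> real^'p \<Rightarrow> real^'n" where
  "rescaled_dual f X lam_t \<beta>_t =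
     (let g = gradient f (X *v \<beta>_t);
          \<alpha>_t = max lam_t (infnorm (transpose X *v g))
      in - (g /\<^sub>R \<alpha>_t))"

definition Delta :: "(real^'n \<Rightarrow> real) \<Rightarrow> real^'p^'n \<Rightarrow> real \<Rightarrow> real^'p \<Rightarrow> real^'n \<Rightarrow> real" where
  "Delta f X lam_t \<beta>_t \<theta>_t =
     (let \<zeta>_t = - (lam_t *\<^sub>R \<theta>_t)
      in f (X *v \<beta>_t) - f (gradient (fenchel_conj f) \<zeta>_t))"

definition E_prime :: "(real^'n \<Rightarrow> real) \<Rightarrow> real^'p^'n \<Rightarrow> real \<Rightarrow> real \<Rightarrow> real^'p \<Rightarrow> real^'n \<Rightarrow> real" where
  "E_prime f X lam lam_t \<beta>_t \<theta>_t =
     1 / lam_t\<^sup>2 * duality_gap f X lam_t \<beta>_t \<theta>_t + (1 / lam\<^sup>2 - 1 / lam_t\<^sup>2) * min 0 (Delta f X lam_t \<beta>_t \<theta>_t)"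

definition E_dprime :: "(real^'n \<Rightarrow> real) \<Rightarrow> real^'p^'n \<Rightarrow> real \<Rightarrow> real \<Rightarrow> real^'p \<Rightarrow> real^'n \<Rightarrow> real" where
  "E_dprime f X lam lam_t \<beta>_t \<theta>_t =
     1 / (lam * lam_t) * duality_gap f X lam_t \<beta>_t \<theta>_t + (1 / lam\<^sup>2 - 1 / lam_t\<^sup>2) * max 0 (Delta f X lam_t \<beta>_t \<theta>_t)"

definition col_dist :: "real^'p^'n \<Rightarrow> real^'n \<Rightarrow> 'p \<Rightarrow> real" where
  "col_dist X \<theta> j = (1 - \<bar>column j X \<bullet> \<theta>\<bar>) / norm (column j X)"

(* d_(k)(\<theta>), the k-th smallest of the CARD('p) values d_j(\<theta>) counted with multiplicity;
   meaningful for 1 \<le> k \<le> CARD('p). *)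
definition ord_dist :: "real^'p^'n \<Rightarrow> real^'n \<Rightarrow> nat \<Rightarrow> real" where
  "ord_dist X \<theta> k =
     sorted_list_of_multiset (image_mset (col_dist X \<theta>) (mset_set UNIV)) ! (k - 1)"

definition safe_radius ::
  "(real^'n \<Rightarrow> real) \<Rightarrow> real^'p^'n \<Rightarrow> real \<Rightarrow> real^'p \<Rightarrow> real^'n \<Rightarrow> real \<Rightarrow> real" where
  "safe_radius f X \<nu> \<beta>_t \<theta>_t \<gamma> = sqrt (2 * \<nu> / \<gamma>\<^sup>2 * duality_gap f X \<gamma> \<beta>_t \<theta>_t)"

definition safe_active ::
  "(real^'n \<Rightarrow> real) \<Rightarrow> real^'p^'n \<Rightarrow> real \<Rightarrow> real^'p \<Rightarrow> real^'n \<Rightarrow> real \<Rightarrow> 'p set" where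
  "safe_active f X \<nu> \<beta>_t \<theta>_t \<gamma> = {j. col_dist X \<theta>_t j \<le> safe_radius f X \<nu> \<beta>_t \<theta>_t \<gamma>}"

definition opt_active :: "(real^'n \<Rightarrow> real) \<Rightarrow> real^'p^'n \<Rightarrow> real \<Rightarrow> 'p set" where
  "opt_active f X \<gamma> = {j. col_dist X (dual_opt f X \<gamma>) j = 0}"

end

theory Submission
  imports Defs
begin

text \<open>The conjugate \<open>f\<^sup>*\<close> inherits a two-sided quadratic bound with constants \<open>1/\<nu>\<close> and \<open>1/\<mu>\<close>.
  Comparing \<open>f\<^sup>*\<close> at \<open>\<zeta>\<^sub>t = -\<lambda>\<^sub>t\<theta>\<^sub>t\<close> and at \<open>(\<gamma>/\<lambda>\<^sub>t)\<zeta>\<^sub>t\<close>, and using Fenchel's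
  equality at \<open>\<zeta>\<^sub>t\<close>, the gap at the new parameter \<open>\<gamma>\<close> equals
  \<open>(\<gamma>/\<lambda>\<^sub>t) Gap\<^sub>t + (1 - \<gamma>/\<lambda>\<^sub>t) \<Delta>\<^sub>t\<close> up to a remainder between
  \<open>(\<lambda>\<^sub>t - \<gamma>)\<^sup>2 \<parallel>\<theta>\<^sub>t\<parallel>\<^sup>2 / (2\<nu>)\<close> and \<open>(\<lambda>\<^sub>t - \<gamma>)\<^sup>2 \<parallel>\<theta>\<^sub>t\<parallel>\<^sup>2 / (2\<mu>)\<close>. This sandwiches the squared safe radius,
  and the two conditions on \<open>\<gamma>\<close> compare it with the squared order statistic. The inclusion
  of the active sets is the safe sphere argument: strong concavity of the dual bounds the
  distance from \<open>\<theta>\<^sub>t\<close> to the dual optimum by the safe radius.\<close>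

section \<open>Order statistics and counting\<close>

text \<open>Sortedness makes the entries at most \<open>r\<close> an initial segment, and an index
  lies in it exactly when it is below its length.\<close>

lemma nth_le_iff_length_filter_le:
  fixes xs :: "'a::linorder list"
  assumes "sorted xs" "i < length xs"
  shows "xs ! i \<le> r \<longleftrightarrow> i < length (filter (\<lambda>x. x \<le> r) xs)"
  using assms
proof (induction xs arbitrary: i)
  case (Cons x xs)
  show ?case
  proof (cases "x \<le> r")
    case True
    then show ?thesis using Cons by (cases i) auto
  next
    case False
    then have big: "\<not> y \<le> r" if "y \<in> set (x # xs)" for y
      using that Cons.prems(1) by auto
    then have "filter (\<lambda>x. x \<le> r) (x # xs) = []"
      by (simp add: filter_empty_conv)
    moreover have "\<not> (x # xs) ! i \<le> r"
      using big nth_mem[OF Cons.prems(2)] by blast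
    ultimately show ?thesis by simp
  qed
qed simp

text \<open>Trades a bound on the order statistic for a count; with the safe radius as
  \<open>r\<close> the count is the size of the safe active set.\<close>

lemma ord_dist_le_iff:
  fixes X :: "real^'p^'n"
  assumes "1 \<le> k" "k \<le> CARD('p)"
  shows "ord_dist X \<theta> k \<le> r \<longleftrightarrow> k \<le> card {j. col_dist X \<theta> j \<le> r}"
proof -
  define M where "M = image_mset (col_dist X \<theta>) (mset_set (UNIV :: 'p set))"
  define xs where "xs = sorted_list_of_multiset M"
  have M: "mset xs = M" by (simp add: xs_def)
  have "length xs = CARD('p)"
    by (simp flip: size_mset add: M) (simp add: M_def)
  moreover have "length (filter (\<lambda>x. x \<le> r) xs) = card {j. col_dist X \<theta> j \<le> r}"
    by (simp flip: size_mset add: M) (simp add: M_def filter_mset_image_mset)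
  moreover have "sorted xs" by (simp add: xs_def)
  \<comment> \<open>List positions start at 0; since \<open>k\<close> is positive,
    \<open>k - 1 < m\<close> is the same as \<open>k \<le> m\<close>.\<close>
  ultimately show ?thesis
    using nth_le_iff_length_filter_le[of xs "k - 1" r] assms
    by (auto simp: ord_dist_def xs_def M_def)
qed

text \<open>Lets a sign shared by all the distances pass to the order statistic.\<close>

lemma ord_dist_mem:
  fixes X :: "real^'p^'n"
  assumes "1 \<le> k" "k \<le> CARD('p)"
  shows "ord_dist X \<theta> k \<in> range (col_dist X \<theta>)"
proof -
  define M where "M = image_mset (col_dist X \<theta>) (mset_set (UNIV :: 'p set))"
  have M: "mset (sorted_list_of_multiset M) = M" by simp
  have "length (sorted_list_of_multiset M) = CARD('p)"
    by (simp flip: size_mset add: M) (simp add: M_def)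
  then have "sorted_list_of_multiset M ! (k - 1) \<in> set (sorted_list_of_multiset M)"
    using assms by (intro nth_mem) auto
  then show ?thesis by (simp add: ord_dist_def M_def)
qed

section \<open>Minimizers under quadratic growth\<close>

text \<open>Outside a large ball the growth lifts \<open>h\<close> above \<open>h s\<close>, so it
  suffices to minimize over a compact piece of \<open>S\<close> that contains
  \<open>s\<close>.\<close>

lemma continuous_attains_inf_quadratic_growth:
  fixes h :: "'a::euclidean_space \<Rightarrow> real"
  assumes S: "closed S" "s \<in> S" and cont: "continuous_on S h"
    and c: "0 < c" and growth: "\<And>x. a + b \<bullet> x + c * (norm x)\<^sup>2 \<le> h x"
  obtains x where "x \<in> S" "\<And>y. y \<in> S \<Longrightarrow> h x \<le> h y"
proof -
  \<comment> \<open>Beyond \<open>R\<close> the factor \<open>c * norm x - norm b\<close> exceeds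
    \<open>\<bar>h s - a\<bar>\<close>; the summand 1 gives \<open>1 \<le> norm x\<close>, so
    multiplying by \<open>norm x\<close> keeps that bound.\<close>
  define R where "R = norm s + (norm b + \<bar>h s - a\<bar>) / c + 1"
  have far: "h s < h x" if "R < norm x" for x
  proof -
    have n1: "1 \<le> norm x" using that c unfolding R_def
      by (smt (verit) divide_nonneg_pos norm_ge_zero)
    have "(norm b + \<bar>h s - a\<bar>) / c < norm x"
      using that unfolding R_def by (smt (verit) norm_ge_zero)
    then have "\<bar>h s - a\<bar> < c * norm x - norm b"
      using c by (simp add: field_simps)
    also have "\<dots> \<le> norm x * (c * norm x - norm b)"
      using mult_right_mono[OF n1, of "c * norm x - norm b"] calculation by simp
    finally have "\<bar>h s - a\<bar> < c * (norm x)\<^sup>2 - norm b * norm x"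
      by (simp add: power2_eq_square algebra_simps)
    moreover have "- (norm b * norm x) \<le> b \<bullet> x"
      using Cauchy_Schwarz_ineq2[of b x] by linarith
    ultimately show ?thesis using growth[of x] by linarith
  qed
  have "s \<in> S \<inter> cball 0 R"
    using S(2) c unfolding R_def by (simp add: divide_nonneg_pos)
  moreover have "compact (S \<inter> cball 0 R)"
    using S(1) by (simp add: closed_Int_compact)
  moreover have "continuous_on (S \<inter> cball 0 R) h"
    using cont continuous_on_subset by blast
  ultimately obtain x where x: "x \<in> S \<inter> cball 0 R" "\<forall>y\<in>S \<inter> cball 0 R. h x \<le> h y"
    using continuous_attains_inf[of "S \<inter> cball 0 R" h] by blast
  have "h x \<le> h y" if "y \<in> S" for y
  proof (cases "norm y \<le> R")
    case True
    then show ?thesis using x that by auto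
  next
    case False
    then have "h s < h y" using far by simp
    moreover have "h x \<le> h s" using x(2) \<open>s \<in> S \<inter> cball 0 R\<close> by blast
    ultimately show ?thesis by simp
  qed
  with x that show thesis by blast
qed

section \<open>Gradients\<close>

lemma gradient_eqI:
  assumes "GDERIV f x :> D"
  shows "gradient f x = D"
  unfolding gradient_def
proof (rule the_equality)
  show "GDERIV f x :> D" by (rule assms)
next
  fix E assume "GDERIV f x :> E"
  then have "(\<lambda>h. h \<bullet> E) = (\<lambda>h. h \<bullet> D)"
    using assms has_derivative_unique unfolding gderiv_def by blast
  \<comment> \<open>Two vectors representing the same functional are compared on their own
    difference.\<close>
  then have "(E - D) \<bullet> E = (E - D) \<bullet> D" by meson
  then have "(E - D) \<bullet> (E - D) = 0" by (simp add: inner_diff_right)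
  then show "E = D" by simp
qed

text \<open>The adjoint of the derivative, applied to 1, is the Riesz representative of that
  functional.\<close>

lemma GDERIV_gradient:
  fixes f :: "'a::euclidean_space \<Rightarrow> real"
  assumes "f differentiable (at x)"
  shows "GDERIV f x :> gradient f x"
proof -
  obtain f' where f': "(f has_derivative f') (at x)"
    using assms by (auto simp: differentiable_def)
  interpret linear f' using f' by (rule has_derivative_linear)
  have "f' = (\<lambda>h. h \<bullet> adjoint f' 1)"
    using adjoint_works[OF linear_axioms, of _ 1] by auto
  then have "GDERIV f x :> adjoint f' 1"
    using f' by (simp add: gderiv_def)
  then show ?thesis using gradient_eqI by metis
qed

text \<open>Divided by \<open>norm (z - x)\<close>, the quadratic error is still at most
  \<open>C * norm (z - x)\<close>, which vanishes in the limit. This is how the conjugate is shown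
  to be differentiable.\<close>

lemma GDERIV_quadratic:
  assumes "\<And>z. \<bar>f z - f x - D \<bullet> (z - x)\<bar> \<le> C * (norm (z - x))\<^sup>2"
  shows "GDERIV f x :> D"
  unfolding gderiv_def has_derivative_at2
proof (intro conjI)
  show "bounded_linear (\<lambda>h. h \<bullet> D)" by (rule bounded_linear_inner_left)
  have "((\<lambda>z. C * norm (z - x)) \<longlongrightarrow> C * norm (x - x)) (at x)"
    by (intro tendsto_intros)
  then have lim: "((\<lambda>z. C * norm (z - x)) \<longlongrightarrow> 0) (at x)" by simp
  have "norm ((1 / norm (z - x)) *\<^sub>R (f z - (f x + (z - x) \<bullet> D))) \<le> C * norm (z - x)" for z
    using assms[of z]
    by (cases "z = x") (simp_all add: field_simps inner_commute power2_eq_square diff_diff_eq)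
  then show "((\<lambda>z. (1 / norm (z - x)) *\<^sub>R (f z - (f x + (z - x) \<bullet> D))) \<longlongrightarrow> 0) (at x)"
    by (intro Lim_null_comparison[OF _ lim] always_eventually allI)
qed

section \<open>The conjugate of a smooth, strongly convex function\<close>

text \<open>Completing the square.\<close>

lemma inner_le_quadratic:
  assumes "0 < \<mu>"
  shows "w \<bullet> z - \<mu> / 2 * (norm z)\<^sup>2 \<le> (norm w)\<^sup>2 / (2 * \<mu>)"
proof -
  have "0 \<le> (norm (w - \<mu> *\<^sub>R z))\<^sup>2" by simp
  also have "\<dots> = (norm w)\<^sup>2 - 2 * \<mu> * (w \<bullet> z) + \<mu>\<^sup>2 * (norm z)\<^sup>2"
    by (simp add: power2_norm_eq_inner inner_diff_left inner_diff_right inner_commute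
        power2_eq_square[of \<mu>])
  finally show ?thesis using assms by (simp add: field_simps power2_eq_square)
qed

lemma smooth_strongly_convexD:
  assumes "smooth_strongly_convex \<mu> \<nu> f"
  shows "0 < \<mu>" "0 < \<nu>" "f differentiable (at z)"
    and "\<mu> / 2 * (norm (z - z0))\<^sup>2 \<le> f z - f z0 - gradient f z0 \<bullet> (z - z0)"
    and "f z - f z0 - gradient f z0 \<bullet> (z - z0) \<le> \<nu> / 2 * (norm (z - z0))\<^sup>2"
  using assms by (auto simp: smooth_strongly_convex_def)

text \<open>The supremum is real-valued, so boundedness comes first: strong convexity expanded at 0
  leaves a concave quadratic in \<open>y\<close>.\<close>

lemma fenchel_young:
  assumes f: "smooth_strongly_convex \<mu> \<nu> f"
  shows "u \<bullet> x - f x \<le> fenchel_conj f u"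
proof -
  note D = smooth_strongly_convexD[OF f]
  have "u \<bullet> y - f y \<le> (norm (u - gradient f 0))\<^sup>2 / (2 * \<mu>) - f 0" for y
    using D(4)[of y 0] inner_le_quadratic[OF D(1), of "u - gradient f 0" y]
    by (simp add: inner_diff_left)
  then have "bdd_above (range (\<lambda>x. u \<bullet> x - f x))" by (auto simp: bdd_above_def)
  then show ?thesis unfolding fenchel_conj_def by (intro cSUP_upper) auto
qed

text \<open>Subtracting the linear form of \<open>v\<close> from \<open>f\<close> keeps the
  quadratic growth; at a minimizer of the difference the gradient of \<open>f\<close> equals
  \<open>v\<close>.\<close>

lemma gradient_surj:
  assumes f: "smooth_strongly_convex \<mu> \<nu> f"
  obtains x where "gradient f x = v"
proof -
  note D = smooth_strongly_convexD[OF f]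
  let ?h = "\<lambda>x. f x - v \<bullet> x"
  have "continuous_on UNIV ?h"
    using D(3) by (intro continuous_intros) (simp add: continuous_on_eq_continuous_at differentiable_imp_continuous_within)
  moreover have "f 0 + (gradient f 0 - v) \<bullet> x + \<mu> / 2 * (norm x)\<^sup>2 \<le> ?h x" for x
    using D(4)[of x 0] by (simp add: inner_diff_left)
  ultimately obtain x where x: "\<And>y. ?h x \<le> ?h y"
    using continuous_attains_inf_quadratic_growth[of UNIV 0 ?h "\<mu> / 2" "f 0" "gradient f 0 - v"] D(1)
    by auto
  have "(?h has_derivative (\<lambda>h. h \<bullet> gradient f x - v \<bullet> h)) (at x)"
    using GDERIV_gradient[OF D(3)[of x]] unfolding gderiv_def
    by (auto intro!: derivative_eq_intros)
  then have "(\<lambda>h. h \<bullet> gradient f x - v \<bullet> h) = (\<lambda>h. 0)"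
    using x differential_zero_maxmin[of x UNIV ?h] by auto
  then have "(gradient f x - v) \<bullet> gradient f x - v \<bullet> (gradient f x - v) = 0" by meson
  then have "(gradient f x - v) \<bullet> (gradient f x - v) = 0"
    by (simp add: inner_diff_left inner_diff_right inner_commute)
  with that show thesis by simp
qed

text \<open>The tangent plane at \<open>x\<close> lies below \<open>f\<close>, so \<open>x\<close>
  attains the supremum.\<close>

lemma fenchel_equality:
  assumes f: "smooth_strongly_convex \<mu> \<nu> f"
  shows "fenchel_conj f (gradient f x) = gradient f x \<bullet> x - f x"
proof (rule antisym)
  note D = smooth_strongly_convexD[OF f]
  have "gradient f x \<bullet> y - f y \<le> gradient f x \<bullet> x - f x" for y
  proof -
    have "0 \<le> \<mu> / 2 * (norm (y - x))\<^sup>2" using D(1) by simp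
    then show ?thesis using D(4)[of y x] by (simp add: inner_diff_right)
  qed
  then show "fenchel_conj f (gradient f x) \<le> gradient f x \<bullet> x - f x"
    unfolding fenchel_conj_def by (intro cSUP_least) auto
qed (rule fenchel_young[OF f])

text \<open>The constants swap roles: smoothness of \<open>f\<close>, tested at one point, gives the
  lower bound; strong convexity, maximized over all points, gives the upper bound.\<close>

lemma fenchel_conj_quadratic_bounds:
  assumes f: "smooth_strongly_convex \<mu> \<nu> f" and x: "gradient f x = v"
  shows "(norm (u - v))\<^sup>2 / (2 * \<nu>) \<le> fenchel_conj f u - fenchel_conj f v - x \<bullet> (u - v)"
    and "fenchel_conj f u - fenchel_conj f v - x \<bullet> (u - v) \<le> (norm (u - v))\<^sup>2 / (2 * \<mu>)"
proof -
  note D = smooth_strongly_convexD[OF f]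
  have conj_v: "fenchel_conj f v = v \<bullet> x - f x"
    using fenchel_equality[OF f, of x] x by simp
  \<comment> \<open>This \<open>w\<close> maximizes
    \<open>(u - v) \<bullet> w - \<nu> / 2 * (w \<bullet> w)\<close>, so \<open>x + w\<close> is the
    best test point under the smoothness bound.\<close>
  define w where "w = (u - v) /\<^sub>R \<nu>"
  have "\<nu> *\<^sub>R w = u - v" using D(2) by (simp add: w_def)
  then have u: "u = v + \<nu> *\<^sub>R w" by (simp add: algebra_simps)
  have sq: "(norm (u - v))\<^sup>2 / (2 * \<nu>) = \<nu> / 2 * (w \<bullet> w)"
    using D(2) by (simp add: u power_mult_distrib power2_norm_eq_inner[symmetric] field_simps power2_eq_square[of \<nu>])
  have "f (x + w) \<le> f x + v \<bullet> w + \<nu> / 2 * (w \<bullet> w)"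
    using D(5)[of "x + w" x] x by (simp add: power2_norm_eq_inner)
  then show "(norm (u - v))\<^sup>2 / (2 * \<nu>) \<le> fenchel_conj f u - fenchel_conj f v - x \<bullet> (u - v)"
    using fenchel_young[OF f, of u "x + w"] unfolding sq
    by (simp add: conj_v u inner_add_left inner_add_right distrib_left inner_commute)
  have "u \<bullet> y - f y \<le> fenchel_conj f v + x \<bullet> (u - v) + (norm (u - v))\<^sup>2 / (2 * \<mu>)" for y
    using D(4)[of y x] inner_le_quadratic[OF D(1), of "u - v" "y - x"]
    by (simp add: conj_v x algebra_simps inner_commute)
  then have "fenchel_conj f u \<le> fenchel_conj f v + x \<bullet> (u - v) + (norm (u - v))\<^sup>2 / (2 * \<mu>)"
    unfolding fenchel_conj_def[of f u] by (intro cSUP_least) auto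
  then show "fenchel_conj f u - fenchel_conj f v - x \<bullet> (u - v) \<le> (norm (u - v))\<^sup>2 / (2 * \<mu>)"
    by simp
qed

lemma GDERIV_fenchel_conj:
  assumes f: "smooth_strongly_convex \<mu> \<nu> f" and x: "gradient f x = v"
  shows "GDERIV (fenchel_conj f) v :> x"
proof (rule GDERIV_quadratic[where C = "1 / (2 * \<mu>)"])
  fix u
  have "0 \<le> (norm (u - v))\<^sup>2 / (2 * \<nu>)"
    using smooth_strongly_convexD(2)[OF f] by simp
  then show "\<bar>fenchel_conj f u - fenchel_conj f v - x \<bullet> (u - v)\<bar> \<le> 1 / (2 * \<mu>) * (norm (u - v))\<^sup>2"
    using fenchel_conj_quadratic_bounds[OF f x, of u] by simp
qed

text \<open>Any preimage of \<open>v\<close> under the gradient of \<open>f\<close> is the gradient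
  of the conjugate at \<open>v\<close>, and a preimage exists.\<close>

lemma gradient_gradient_fenchel_conj:
  assumes f: "smooth_strongly_convex \<mu> \<nu> f"
  shows "gradient f (gradient (fenchel_conj f) v) = v"
  using gradient_surj[OF f, of v] gradient_eqI[OF GDERIV_fenchel_conj[OF f]] by metis

lemma continuous_on_fenchel_conj:
  assumes f: "smooth_strongly_convex \<mu> \<nu> f"
  shows "continuous_on UNIV (fenchel_conj f)"
  using GDERIV_fenchel_conj[OF f gradient_gradient_fenchel_conj[OF f]]
  unfolding gderiv_def continuous_on_eq_continuous_at[OF open_UNIV]
  by (blast intro: has_derivative_continuous)

section \<open>Weak duality and the dual feasible set\<close>

text \<open>Hoelder's inequality for the pairing of the coefficients with the column
  correlations.\<close>

lemma abs_inner_matrix_vector_mult_le: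
  assumes "\<theta> \<in> dual_feasible X"
  shows "\<bar>\<theta> \<bullet> (X *v \<beta>)\<bar> \<le> l1_norm \<beta>"
proof -
  have "\<theta> \<bullet> (X *v \<beta>) = (\<Sum>j\<in>UNIV. \<beta> $ j * (column j X \<bullet> \<theta>))"
    by (simp add: matrix_mult_sum inner_sum_right inner_commute scalar_mult_eq_scaleR)
  also have "\<bar>\<dots>\<bar> \<le> (\<Sum>j\<in>UNIV. \<bar>\<beta> $ j\<bar> * 1)"
    using assms unfolding dual_feasible_def
    by (intro order_trans[OF sum_abs] sum_mono) (auto simp: abs_mult intro!: mult_left_le)
  finally show ?thesis by (simp add: l1_norm_def)
qed

text \<open>Fenchel-Young at \<open>X *v \<beta>\<close>, with the inner product absorbed by the
  penalty.\<close>

lemma duality_gap_nonneg: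
  assumes f: "smooth_strongly_convex \<mu> \<nu> f" and "\<theta> \<in> dual_feasible X" "0 < \<gamma>"
  shows "0 \<le> duality_gap f X \<gamma> \<beta> \<theta>"
proof -
  have "\<gamma> * (\<theta> \<bullet> (X *v \<beta>)) \<le> \<gamma> * l1_norm \<beta>"
    using abs_inner_matrix_vector_mult_le[OF assms(2), of \<beta>] \<open>0 < \<gamma>\<close> by (intro mult_left_mono) auto
  then show ?thesis
    using fenchel_young[OF f, of "- (\<gamma> *\<^sub>R \<theta>)" "X *v \<beta>"]
    by (simp add: duality_gap_def primal_obj_def dual_obj_def)
qed

text \<open>The scaling \<open>\<alpha>\<close> dominates every correlation of a column with the
  gradient.\<close>

lemma rescaled_dual_feasible:
  assumes "0 < lam_t"
  shows "rescaled_dual f X lam_t \<beta> \<in> dual_feasible X"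
proof -
  define g where "g = gradient f (X *v \<beta>)"
  define \<alpha> where "\<alpha> = max lam_t (infnorm (transpose X *v g))"
  have \<alpha>: "0 < \<alpha>" using assms by (simp add: \<alpha>_def)
  have "\<bar>column j X \<bullet> g\<bar> \<le> \<alpha>" for j
  proof -
    have "column j X \<bullet> g = (transpose X *v g) $ j"
      by (simp add: matrix_vector_mult_def transpose_def column_def inner_vec_def del: transpose_matrix_vector)
    then have "\<bar>column j X \<bullet> g\<bar> \<le> infnorm (transpose X *v g)"
      using component_le_infnorm_cart by metis
    then show ?thesis by (simp add: \<alpha>_def)
  qed
  then have "\<bar>column j X \<bullet> (- (g /\<^sub>R \<alpha>))\<bar> \<le> 1" for j
    using \<alpha> by (simp add: abs_mult field_simps)
  then show ?thesis
    by (simp add: dual_feasible_def rescaled_dual_def Let_def g_def \<alpha>_def)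
qed

lemma closed_dual_feasible: "closed (dual_feasible X)"
  unfolding dual_feasible_def by (intro closed_Collect_all closed_Collect_le continuous_intros)

lemma convex_dual_feasible: "convex (dual_feasible X)"
proof -
  have "dual_feasible X = (\<Inter>j. {\<theta>. column j X \<bullet> \<theta> \<le> 1} \<inter> {\<theta>. - column j X \<bullet> \<theta> \<le> 1})"
    by (auto simp: dual_feasible_def abs_le_iff)
  then show ?thesis by (simp add: convex_INT convex_Int convex_halfspace_le del: inner_minus_left)
qed

section \<open>The dual optimum and the safe sphere\<close>

lemma dual_opt_is_maximizer:
  assumes f: "smooth_strongly_convex \<mu> \<nu> f" and "0 < \<gamma>"
  shows "dual_opt f X \<gamma> \<in> dual_feasible X"
    and "\<theta> \<in> dual_feasible X \<Longrightarrow> dual_obj f \<gamma> \<theta> \<le> dual_obj f \<gamma> (dual_opt f X \<gamma>)"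
proof -
  note D = smooth_strongly_convexD[OF f]
  let ?h = "\<lambda>\<theta>. fenchel_conj f (- (\<gamma> *\<^sub>R \<theta>))"
  \<comment> \<open>Expanding the conjugate at 0 supplies the quadratic growth of the negated dual
    objective.\<close>
  obtain x where x: "gradient f x = 0" using gradient_surj[OF f] .
  have "fenchel_conj f 0 + (- (\<gamma> *\<^sub>R x)) \<bullet> \<theta> + \<gamma>\<^sup>2 / (2 * \<nu>) * (norm \<theta>)\<^sup>2 \<le> ?h \<theta>" for \<theta>
    using fenchel_conj_quadratic_bounds(1)[OF f x, of "- (\<gamma> *\<^sub>R \<theta>)"]
    by (simp add: power_mult_distrib)
  moreover have "continuous_on (dual_feasible X) ?h"
    by (rule continuous_on_compose2[OF continuous_on_fenchel_conj[OF f]])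
      (auto intro!: continuous_intros)
  moreover have "0 \<in> dual_feasible X" by (simp add: dual_feasible_def)
  moreover have "0 < \<gamma>\<^sup>2 / (2 * \<nu>)" using D(2) \<open>0 < \<gamma>\<close> by simp
  ultimately obtain m where "m \<in> dual_feasible X" "\<And>y. y \<in> dual_feasible X \<Longrightarrow> ?h m \<le> ?h y"
    using continuous_attains_inf_quadratic_growth[OF closed_dual_feasible[of X]] by metis
  then have "is_arg_max (dual_obj f \<gamma>) (\<lambda>x. x \<in> dual_feasible X) m"
    by (force simp: is_arg_max_def dual_obj_def)
  \<comment> \<open>\<open>dual_opt\<close> is a choice among maximizers, so exhibiting one is
    enough.\<close>
  then have "is_arg_max (dual_obj f \<gamma>) (\<lambda>x. x \<in> dual_feasible X) (dual_opt f X \<gamma>)"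
    unfolding dual_opt_def arg_max_on_def arg_max_def by (rule someI)
  then show "dual_opt f X \<gamma> \<in> dual_feasible X"
    and "\<theta> \<in> dual_feasible X \<Longrightarrow> dual_obj f \<gamma> \<theta> \<le> dual_obj f \<gamma> (dual_opt f X \<gamma>)"
    by (auto simp: is_arg_max_def not_less)
qed

lemma norm_dual_opt_diff_le_safe_radius:
  assumes f: "smooth_strongly_convex \<mu> \<nu> f" and \<gamma>: "0 < \<gamma>" and \<theta>: "\<theta> \<in> dual_feasible X"
  shows "norm (\<theta> - dual_opt f X \<gamma>) \<le> safe_radius f X \<nu> \<beta> \<theta> \<gamma>"
proof -
  note D = smooth_strongly_convexD[OF f]
  define m where "m = dual_opt f X \<gamma>"
  define v u where "v = - (\<gamma> *\<^sub>R m)" and "u = - (\<gamma> *\<^sub>R \<theta>)"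
  note opt = dual_opt_is_maximizer[OF f \<gamma>, where X = X, folded m_def]
  obtain x where x: "gradient f x = v" using gradient_surj[OF f] .
  define B where "B = (norm (u - v))\<^sup>2 / (2 * \<mu>)"
  \<comment> \<open>Moving from the optimum \<open>m\<close> towards \<open>\<theta>\<close> cannot
    lower the negated dual objective. The quadratic error has a factor \<open>t\<^sup>2\<close>, so
    division by \<open>t\<close> leaves \<open>t * B\<close>, and \<open>t\<close> tending to 0
    gives first-order optimality.\<close>
  have step: "0 \<le> x \<bullet> (u - v) + t * B" if t: "0 < t" "t < 1" for t
  proof -
    have "(1 - t) *\<^sub>R m + t *\<^sub>R \<theta> \<in> dual_feasible X"
      using convex_dual_feasible opt(1) \<theta> t by (intro convexD) auto
    moreover have "- (\<gamma> *\<^sub>R ((1 - t) *\<^sub>R m + t *\<^sub>R \<theta>)) = v + t *\<^sub>R (u - v)"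
      by (simp add: u_def v_def algebra_simps)
    ultimately have "fenchel_conj f v \<le> fenchel_conj f (v + t *\<^sub>R (u - v))"
      using opt(2)[of "(1 - t) *\<^sub>R m + t *\<^sub>R \<theta>"] by (simp add: dual_obj_def v_def)
    then have "0 \<le> t * (x \<bullet> (u - v)) + t\<^sup>2 * B"
      using fenchel_conj_quadratic_bounds(2)[OF f x, of "v + t *\<^sub>R (u - v)"]
      by (simp add: B_def power_mult_distrib)
    then have "0 \<le> t * (x \<bullet> (u - v) + t * B)" by (simp add: power2_eq_square algebra_simps)
    then show ?thesis using t by (simp add: zero_le_mult_iff)
  qed
  have "((\<lambda>t. x \<bullet> (u - v) + t * B) \<longlongrightarrow> x \<bullet> (u - v) + 0 * B) (at_right 0)"
    by (intro tendsto_intros)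
  moreover have "\<forall>\<^sub>F t in at_right 0. 0 \<le> x \<bullet> (u - v) + t * B"
    using step eventually_at_right_real[of 0 1] by (auto elim!: eventually_mono)
  ultimately have "0 \<le> x \<bullet> (u - v) + 0 * B"
    by (intro tendsto_lowerbound) auto
  then have "(norm (u - v))\<^sup>2 / (2 * \<nu>) \<le> fenchel_conj f u - fenchel_conj f v"
    using fenchel_conj_quadratic_bounds(1)[OF f x, of u] by simp
  \<comment> \<open>Weak duality at \<open>m\<close>: the optimal dual value is at most the primal
    value at \<open>\<beta>\<close>.\<close>
  also have "\<dots> \<le> duality_gap f X \<gamma> \<beta> \<theta>"
    using duality_gap_nonneg[OF f opt(1) \<gamma>, of \<beta>]
    by (simp add: duality_gap_def dual_obj_def u_def v_def)
  finally have "(norm (u - v))\<^sup>2 / (2 * \<nu>) \<le> duality_gap f X \<gamma> \<beta> \<theta>" .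
  moreover have "norm (u - v) = \<gamma> * norm (\<theta> - m)"
  proof -
    have "u - v = (- \<gamma>) *\<^sub>R (\<theta> - m)" by (simp add: u_def v_def algebra_simps)
    then show ?thesis using \<gamma> by simp
  qed
  ultimately have "(norm (\<theta> - m))\<^sup>2 \<le> 2 * \<nu> / \<gamma>\<^sup>2 * duality_gap f X \<gamma> \<beta> \<theta>"
    using \<gamma> D(2) by (simp add: field_simps power_mult_distrib)
  then show ?thesis by (simp add: safe_radius_def m_def real_le_rsqrt)
qed

text \<open>An optimal active constraint is tight at the dual optimum, so by Cauchy-Schwarz its
  distance at \<open>\<theta>\<close> is at most the distance from \<open>\<theta>\<close> to that
  optimum.\<close>

lemma opt_active_subset_safe_active:
  assumes f: "smooth_strongly_convex \<mu> \<nu> f" and \<gamma>: "0 < \<gamma>" and \<theta>: "\<theta> \<in> dual_feasible X"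
    and X: "\<forall>j. column j X \<noteq> 0"
  shows "opt_active f X \<gamma> \<subseteq> safe_active f X \<nu> \<beta> \<theta> \<gamma>"
proof
  fix j assume "j \<in> opt_active f X \<gamma>"
  define m where "m = dual_opt f X \<gamma>"
  have "\<bar>column j X \<bullet> m\<bar> = 1"
    using \<open>j \<in> _\<close> X by (simp add: opt_active_def col_dist_def m_def)
  then have "1 - \<bar>column j X \<bullet> \<theta>\<bar> \<le> \<bar>column j X \<bullet> (\<theta> - m)\<bar>"
    by (simp add: inner_diff_right)
  also have "\<dots> \<le> norm (column j X) * norm (\<theta> - m)" by (rule Cauchy_Schwarz_ineq2)
  finally have "col_dist X \<theta> j \<le> norm (\<theta> - m)"
    using X by (simp add: col_dist_def field_simps)
  also have "\<dots> \<le> safe_radius f X \<nu> \<beta> \<theta> \<gamma>"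
    unfolding m_def by (rule norm_dual_opt_diff_le_safe_radius[OF f \<gamma> \<theta>])
  finally show "j \<in> safe_active f X \<nu> \<beta> \<theta> \<gamma>" by (simp add: safe_active_def)
qed

section \<open>The duality gap under a change of parameter\<close>

lemma duality_gap_change_of_parameter:
  fixes \<gamma> lam_t :: real and X :: "real^'p^'n"
    and \<beta> :: "real^'p" and \<theta> :: "real^'n"
  assumes f: "smooth_strongly_convex \<mu> \<nu> f" and "0 < lam_t"
  defines "\<rho> \<equiv> \<gamma> / lam_t"
  defines "R \<equiv> duality_gap f X \<gamma> \<beta> \<theta>
    - (\<rho> * duality_gap f X lam_t \<beta> \<theta> + (1 - \<rho>) * Delta f X lam_t \<beta> \<theta>)"
  shows "(lam_t - \<gamma>)\<^sup>2 * (norm \<theta>)\<^sup>2 / (2 * \<nu>) \<le> R"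
    and "R \<le> (lam_t - \<gamma>)\<^sup>2 * (norm \<theta>)\<^sup>2 / (2 * \<mu>)"
proof -
  define \<zeta> x where "\<zeta> = - (lam_t *\<^sub>R \<theta>)" and "x = gradient (fenchel_conj f) \<zeta>"
  have x: "gradient f x = \<zeta>" unfolding x_def by (rule gradient_gradient_fenchel_conj[OF f])
  have \<gamma>: "\<gamma> = \<rho> * lam_t" using \<open>0 < lam_t\<close> by (simp add: \<rho>_def)
  define u where "u = - (\<gamma> *\<^sub>R \<theta>)"
  have u: "u = \<rho> *\<^sub>R \<zeta>" by (simp add: u_def \<zeta>_def \<gamma>)
  have diff: "u - \<zeta> = (lam_t - \<gamma>) *\<^sub>R \<theta>" by (simp add: u_def \<zeta>_def algebra_simps)
  \<comment> \<open>The terms \<open>f (X *v \<beta>)\<close> cancel because the weights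
    \<open>\<rho>\<close> and \<open>1 - \<rho>\<close> sum to 1, the penalties because
    \<open>\<gamma> = \<rho> * lam_t\<close>. What remains is the first-order remainder of the
    conjugate at \<open>\<zeta>\<close>.\<close>
  have "R = fenchel_conj f u - \<rho> * fenchel_conj f \<zeta> + (1 - \<rho>) * f x"
    by (simp add: R_def duality_gap_def primal_obj_def dual_obj_def Delta_def Let_def
        u_def[symmetric] \<zeta>_def[symmetric] x_def[symmetric])
      (simp add: \<gamma> algebra_simps)
  also have "\<dots> = fenchel_conj f u - fenchel_conj f \<zeta> - x \<bullet> (u - \<zeta>)"
  proof -
    have "f x = \<zeta> \<bullet> x - fenchel_conj f \<zeta>" using fenchel_equality[OF f, of x] x by simp
    then show ?thesis by (simp only: u inner_diff_right inner_scaleR_right inner_commute[of x])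
        (simp add: algebra_simps)
  qed
  finally have R: "R = fenchel_conj f u - fenchel_conj f \<zeta> - x \<bullet> (u - \<zeta>)" .
  have "(norm (u - \<zeta>))\<^sup>2 = (lam_t - \<gamma>)\<^sup>2 * (norm \<theta>)\<^sup>2"
    by (simp add: diff power_mult_distrib)
  with fenchel_conj_quadratic_bounds[OF f x, of u]
  show "(lam_t - \<gamma>)\<^sup>2 * (norm \<theta>)\<^sup>2 / (2 * \<nu>) \<le> R"
    and "R \<le> (lam_t - \<gamma>)\<^sup>2 * (norm \<theta>)\<^sup>2 / (2 * \<mu>)"
    unfolding R by simp_all
qed

text \<open>After division by \<open>\<gamma>\<^sup>2\<close> the weights of the gap and of
  \<open>Delta\<close> still depend on \<open>\<gamma>\<close>. Monotonicity on
  \<open>[lam, lam_t]\<close> replaces them by fixed ones, which gives \<open>E_prime\<close> and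
  \<open>E_dprime\<close>.\<close>

lemma gap_over_square_bounds:
  assumes f: "smooth_strongly_convex \<mu> \<nu> f" and lam: "0 < lam" "lam \<le> \<gamma>" "\<gamma> \<le> lam_t"
    and \<theta>: "\<theta> \<in> dual_feasible X"
  shows "2 * \<nu> * E_prime f X lam lam_t \<beta> \<theta> + ((lam_t / \<gamma> - 1) * norm \<theta>)\<^sup>2
      \<le> 2 * \<nu> / \<gamma>\<^sup>2 * duality_gap f X \<gamma> \<beta> \<theta>"
    and "2 * \<nu> / \<gamma>\<^sup>2 * duality_gap f X \<gamma> \<beta> \<theta>
      \<le> 2 * \<nu> * E_dprime f X lam lam_t \<beta> \<theta> + \<nu> / \<mu> * ((lam_t / \<gamma> - 1) * norm \<theta>)\<^sup>2"
proof -
  note D = smooth_strongly_convexD[OF f]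
  have pos: "0 < \<gamma>" "0 < lam_t" using lam by auto
  define G where "G = duality_gap f X lam_t \<beta> \<theta>"
  define \<Delta> where "\<Delta> = Delta f X lam_t \<beta> \<theta>"
  define N where "N = ((lam_t / \<gamma> - 1) * norm \<theta>)\<^sup>2"
  define c where "c = 1 / \<gamma>\<^sup>2 - 1 / (\<gamma> * lam_t)"
  define C where "C = 1 / lam\<^sup>2 - 1 / lam_t\<^sup>2"
  have G: "0 \<le> G" unfolding G_def by (rule duality_gap_nonneg[OF f \<theta> pos(2)])
  have gt: "\<gamma> * \<gamma> \<le> \<gamma> * lam_t" "\<gamma> * lam_t \<le> lam_t * lam_t" "lam * lam \<le> \<gamma> * \<gamma>"
      "lam * lam_t \<le> \<gamma> * lam_t"
    using lam pos by (auto intro!: mult_mono)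
  have c0: "0 \<le> c" using gt(1) pos by (simp add: c_def power2_eq_square frac_le)
  have "1 / \<gamma>\<^sup>2 \<le> 1 / lam\<^sup>2" "1 / lam_t\<^sup>2 \<le> 1 / (\<gamma> * lam_t)"
    using gt lam pos unfolding power2_eq_square by (auto intro!: frac_le)
  then have cC: "c \<le> C" by (simp add: c_def C_def)
  have Nsq: "N = (lam_t - \<gamma>)\<^sup>2 * (norm \<theta>)\<^sup>2 / \<gamma>\<^sup>2"
  proof -
    have "lam_t / \<gamma> - 1 = (lam_t - \<gamma>) / \<gamma>" using pos by (simp add: field_simps)
    then show ?thesis by (simp add: N_def power_mult_distrib power_divide)
  qed
  define r where "r = duality_gap f X \<gamma> \<beta> \<theta>"
  have split: "r / \<gamma>\<^sup>2 = 1 / (\<gamma> * lam_t) * G + c * \<Delta>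
      + (r - (\<gamma> / lam_t * G + (1 - \<gamma> / lam_t) * \<Delta>)) / \<gamma>\<^sup>2"
    using pos by (simp add: c_def field_simps power2_eq_square)
  note R = duality_gap_change_of_parameter[OF f pos(2), where \<gamma> = \<gamma> and X = X and \<beta> = \<beta> and \<theta> = \<theta>,
      folded r_def G_def \<Delta>_def]
  have scale: "2 * \<nu> / \<gamma>\<^sup>2 * r = 2 * \<nu> * (r / \<gamma>\<^sup>2)" by simp
  have "N / (2 * \<nu>) \<le> (r - (\<gamma> / lam_t * G + (1 - \<gamma> / lam_t) * \<Delta>)) / \<gamma>\<^sup>2"
    using divide_right_mono[OF R(1), of "\<gamma>\<^sup>2"] by (simp add: Nsq field_simps)
  moreover have "1 / lam_t\<^sup>2 * G \<le> 1 / (\<gamma> * lam_t) * G"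
    using G \<open>1 / lam_t\<^sup>2 \<le> _\<close> by (intro mult_right_mono)
  \<comment> \<open>The sign of \<open>\<Delta>\<close> is unknown; as
    \<open>0 \<le> c \<le> C\<close>, its negative part takes the larger weight and its positive
    part is dropped.\<close>
  moreover have "C * min 0 \<Delta> \<le> c * \<Delta>"
  proof -
    have "C * min 0 \<Delta> \<le> c * min 0 \<Delta>" using cC by (intro mult_right_mono_neg) auto
    also have "\<dots> \<le> c * \<Delta>" using c0 by (intro mult_left_mono) auto
    finally show ?thesis .
  qed
  ultimately have "E_prime f X lam lam_t \<beta> \<theta> + N / (2 * \<nu>) \<le> r / \<gamma>\<^sup>2"
    unfolding split by (simp add: E_prime_def G_def \<Delta>_def C_def)
  then have "2 * \<nu> * (E_prime f X lam lam_t \<beta> \<theta> + N / (2 * \<nu>)) \<le> 2 * \<nu> * (r / \<gamma>\<^sup>2)"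
    using D(2) by (intro mult_left_mono) auto
  then show "2 * \<nu> * E_prime f X lam lam_t \<beta> \<theta> + ((lam_t / \<gamma> - 1) * norm \<theta>)\<^sup>2
      \<le> 2 * \<nu> / \<gamma>\<^sup>2 * duality_gap f X \<gamma> \<beta> \<theta>"
    unfolding N_def[symmetric] r_def[symmetric] scale using D(2) by (simp add: distrib_left)
  have "(r - (\<gamma> / lam_t * G + (1 - \<gamma> / lam_t) * \<Delta>)) / \<gamma>\<^sup>2 \<le> N / (2 * \<mu>)"
    using divide_right_mono[OF R(2), of "\<gamma>\<^sup>2"] by (simp add: Nsq field_simps)
  moreover have "1 / (\<gamma> * lam_t) * G \<le> 1 / (lam * lam_t) * G"
    using G gt(4) lam pos by (intro mult_right_mono frac_le) auto
  moreover have "c * \<Delta> \<le> C * max 0 \<Delta>"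
  proof -
    have "c * \<Delta> \<le> c * max 0 \<Delta>" using c0 by (intro mult_left_mono) auto
    also have "\<dots> \<le> C * max 0 \<Delta>" using cC by (intro mult_right_mono) auto
    finally show ?thesis .
  qed
  ultimately have "r / \<gamma>\<^sup>2 \<le> E_dprime f X lam lam_t \<beta> \<theta> + N / (2 * \<mu>)"
    unfolding split by (simp add: E_dprime_def G_def \<Delta>_def C_def)
  then have "2 * \<nu> * (r / \<gamma>\<^sup>2) \<le> 2 * \<nu> * (E_dprime f X lam lam_t \<beta> \<theta> + N / (2 * \<mu>))"
    using D(2) by (intro mult_left_mono) auto
  then show "2 * \<nu> / \<gamma>\<^sup>2 * duality_gap f X \<gamma> \<beta> \<theta>
      \<le> 2 * \<nu> * E_dprime f X lam lam_t \<beta> \<theta> + \<nu> / \<mu> * ((lam_t / \<gamma> - 1) * norm \<theta>)\<^sup>2"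
    unfolding N_def[symmetric] r_def[symmetric] scale using D(1) by (simp add: distrib_left)
qed

theorem corollary1:
  fixes f :: "real^'n \<Rightarrow> real"
    and X :: "real^'p^'n"
    and \<mu> \<nu> lam lam_t lam_t1 :: real
    and \<beta>_t :: "real^'p"
    and \<theta>_t :: "real^'n"
    and p_t :: nat
  assumes "smooth_strongly_convex \<mu> \<nu> f"
    and "\<forall>j. column j X \<noteq> 0"
    and "0 < lam" and "lam \<le> lam_t1" and "lam_t1 \<le> lam_t"
    and "\<theta>_t = rescaled_dual f X lam_t \<beta>_t"
    and "1 \<le> p_t"
    and "card (safe_active f X \<nu> \<beta>_t \<theta>_t lam_t) \<le> p_t" and "p_t \<le> CARD('p)"
  shows
    "(0 \<le> (ord_dist X \<theta>_t p_t)\<^sup>2 - 2 * \<nu> * E_dprime f X lam lam_t \<beta>_t \<theta>_t \<longrightarrow>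
      norm \<theta>_t + sqrt (\<mu> / \<nu> * ((ord_dist X \<theta>_t p_t)\<^sup>2 - 2 * \<nu> * E_dprime f X lam lam_t \<beta>_t \<theta>_t)) \<noteq> 0 \<longrightarrow>
      lam_t1 > lam_t * norm \<theta>_t /
        (norm \<theta>_t + sqrt (\<mu> / \<nu> * ((ord_dist X \<theta>_t p_t)\<^sup>2 - 2 * \<nu> * E_dprime f X lam lam_t \<beta>_t \<theta>_t))) \<longrightarrow>
      card (safe_active f X \<nu> \<beta>_t \<theta>_t lam_t1) < p_t \<and> card (opt_active f X lam_t1) < p_t)
   \<and> opt_active f X lam_t1 \<subseteq> safe_active f X \<nu> \<beta>_t \<theta>_t lam_t1
   \<and> (lam_t1 \<le> lam_t * norm \<theta>_t /
        (norm \<theta>_t + sqrt ((ord_dist X \<theta>_t p_t)\<^sup>2 - 2 * \<nu> * E_prime f X lam lam_t \<beta>_t \<theta>_t)) \<longrightarrow>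
      card (safe_active f X \<nu> \<beta>_t \<theta>_t lam_t1) \<ge> p_t)"
proof -
  note f = assms(1) and X = assms(2)
  note D = smooth_strongly_convexD[OF f]
  have pos: "0 < lam_t1" "0 < lam_t" using assms by auto
  have feas: "\<theta>_t \<in> dual_feasible X"
    using rescaled_dual_feasible[OF pos(2)] assms(6) by simp
  let ?d = "ord_dist X \<theta>_t p_t" and ?r = "safe_radius f X \<nu> \<beta>_t \<theta>_t lam_t1"
  let ?E' = "E_prime f X lam lam_t \<beta>_t \<theta>_t" and ?E'' = "E_dprime f X lam lam_t \<beta>_t \<theta>_t"
  let ?n = "norm \<theta>_t"
  \<comment> \<open>For a positive denominator, clearing it turns a comparison of
    \<open>lam_t1\<close> with the threshold into one of \<open>k\<close> with the square
    root.\<close>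
  define k where "k = (lam_t / lam_t1 - 1) * ?n"
  have k0: "0 \<le> k" using assms(5) pos by (simp add: k_def)
  \<comment> \<open>Feasibility makes every distance nonnegative, so the order statistic can be
    compared with the radius through squares.\<close>
  have d0: "0 \<le> ?d"
    using ord_dist_mem[OF assms(7,9), of X \<theta>_t] feas
    by (auto simp: col_dist_def dual_feasible_def)
  define G where "G = 2 * \<nu> / lam_t1\<^sup>2 * duality_gap f X lam_t1 \<beta>_t \<theta>_t"
  have r: "?r = sqrt G" by (simp add: safe_radius_def G_def)
  have lower: "2 * \<nu> * ?E' + k\<^sup>2 \<le> G" and upper: "G \<le> 2 * \<nu> * ?E'' + \<nu> / \<mu> * k\<^sup>2"
    using gap_over_square_bounds[OF f assms(3,4,5) feas, of \<beta>_t] by (simp_all add: G_def k_def)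
  have count: "p_t \<le> card (safe_active f X \<nu> \<beta>_t \<theta>_t lam_t1) \<longleftrightarrow> ?d \<le> ?r"
    unfolding safe_active_def by (simp add: ord_dist_le_iff[OF assms(7,9)])
  have sub: "opt_active f X lam_t1 \<subseteq> safe_active f X \<nu> \<beta>_t \<theta>_t lam_t1"
    by (rule opt_active_subset_safe_active[OF f pos(1) feas X])
  have a: "card (safe_active f X \<nu> \<beta>_t \<theta>_t lam_t1) < p_t"
    if nonneg: "0 \<le> ?d\<^sup>2 - 2 * \<nu> * ?E''"
      and ne: "?n + sqrt (\<mu> / \<nu> * (?d\<^sup>2 - 2 * \<nu> * ?E'')) \<noteq> 0"
      and gt: "lam_t1 > lam_t * ?n / (?n + sqrt (\<mu> / \<nu> * (?d\<^sup>2 - 2 * \<nu> * ?E'')))"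
  proof -
    define T where "T = \<mu> / \<nu> * (?d\<^sup>2 - 2 * \<nu> * ?E'')"
    have "0 \<le> T" using nonneg D(1,2) by (simp add: T_def)
    \<comment> \<open>\<open>ne\<close> excludes a zero denominator, for which the quotient would be
      0 by convention.\<close>
    then have "0 < ?n + sqrt T" using ne unfolding T_def[symmetric]
      by (smt (verit) norm_ge_zero real_sqrt_ge_zero)
    then have "k < sqrt T" using gt pos unfolding T_def[symmetric] k_def
      by (simp add: field_simps)
    then have "k\<^sup>2 < T" using k0 \<open>0 \<le> T\<close> power_strict_mono[of k "sqrt T" 2] by simp
    then have "\<nu> / \<mu> * k\<^sup>2 < \<nu> / \<mu> * T"
      using D(1,2) by (intro mult_strict_left_mono) auto
    also have "\<dots> = ?d\<^sup>2 - 2 * \<nu> * ?E''" using D(1,2) by (simp add: T_def)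
    finally have "G < ?d\<^sup>2" using upper by linarith
    then have "?r < ?d" using d0 r real_sqrt_less_mono[of G "?d\<^sup>2"] by simp
    then show ?thesis using count by linarith
  qed
  have b: "p_t \<le> card (safe_active f X \<nu> \<beta>_t \<theta>_t lam_t1)"
    if le: "lam_t1 \<le> lam_t * ?n / (?n + sqrt (?d\<^sup>2 - 2 * \<nu> * ?E'))"
  proof -
    define T where "T = ?d\<^sup>2 - 2 * \<nu> * ?E'"
    have "T \<le> k\<^sup>2"
    proof (cases "T \<le> 0")
      \<comment> \<open>Here the library's \<open>sqrt T\<close> is \<open>- sqrt \<bar>T\<bar>\<close>, so the threshold carries no information.\<close>
      case True
      then show ?thesis using zero_le_power2[of k] by linarith
    next
      case False
      then have "0 < ?n + sqrt T" by (simp add: add_nonneg_pos)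
      then have "sqrt T \<le> k" using le pos unfolding T_def[symmetric] k_def
        by (simp add: field_simps)
      then show ?thesis using False by (simp add: sqrt_le_D)
    qed
    then have "?d\<^sup>2 \<le> G" using lower by (simp add: T_def)
    then show ?thesis unfolding count r by (simp add: real_le_rsqrt)
  qed
  show ?thesis
    using a b sub card_mono[OF finite sub] by (intro conjI impI) (auto intro: le_less_trans)
qed

end
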